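(* Let $1/D(q)=\sum_{r\ge0}\beta(r)q^r$. There are functions $H_D$ and $H_{W,n}$ ($n\ge0$), holomorphic in $|q|<R_*$, such that $$\frac1{D(q)}=\frac1{D'(q_0)(q-q_0)}+H_D(q),\qquad W_n(q)=\frac{N_n(q_0)}{D'(q_0)(q-q_0)}+H_{W,n}(q).$$ For every fixed $R$ with $1/2<R<R_*$, $$\beta(r)=-\frac{q_0^{-r}}{q_0D'(q_0)}+O_R(R^{-r}).$$ For every such $R$ and every fixed $n\ge0$, $$[q^r]W_n(q)=-\frac{N_n(q_0)}{q_0D'(q_0)}q_0^{-r}+O_{n,R}(R^{-r}).$$ In particular, $\beta(r)\ne0$ for all sufficiently large $r$, and $$\frac{[q^r]W_n}{\beta(r)}\longrightarrow N_n(q_0)\qquad(r\to\infty).$$ The principal part of $W_n$ at $q_0$ is nonzero if and only if $N_n(q_0)\ne0$. Under this hypothesis, $[q^r]W_n(q)\neq0$ for all sufficiently large $r$, and $$\frac{[q^{r+1}]W_n}{[q^r]W_n}\longrightarrow q_0^{-1}\qquad(r\to\infty).$$ For $n=1$ (and every $R$ with $1/2<R<R_*$), $$[q^r]W_1(q)=-8q_0^{-r}+O_R(R^{-r}).$$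
   Context: Put $T_k=k(k+1)/2$. For integers $n\ge0$ and complex $|q|<1$, $N_n(q):=\sum_{k\ge0}(-1)^{T_k}(2k+1)^{2n+1}q^{T_k}$, $D:=N_0$, and $W_n:=N_n/D$ (meromorphic in $|q|<1$; $D(0)=1$, and $[q^r]W_n$ is the $r$-th Taylor coefficient at $q=0$). $D$ has exactly one zero $q_0$ in $|q|<1/2$; it is simple, real and positive, with $29/100<q_0<293/1000$. Define $$R_*:=\min\Bigl\{1,\ \inf\{|z|:|z|<1,\ D(z)=0,\ z\ne q_0\}\Bigr\},\qquad \inf\varnothing:=+\infty .$$ One has $R_*\in(1/2,1]$, and $q_0$ is the only zero of $D$ in $|q|<R_*$. Subscripts on $O$ indicate the parameters on which the implied constant may depend. *)

theory Defs
  imports "HOL-Complex_Analysis.Complex_Analysis" "HOL-Library.Landau_Symbols"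
begin

definition tri :: "nat \<Rightarrow> nat" where
  "tri k = k * (k + 1) div 2"

text \<open>The series converges for \<open>norm q < 1\<close>; its values elsewhere are never used.\<close>

definition N_ser :: "nat \<Rightarrow> complex \<Rightarrow> complex" where
  "N_ser n q = (\<Sum>k. (-1) ^ tri k * of_nat (2 * k + 1) ^ (2 * n + 1) * q ^ tri k)"

definition D_ser :: "complex \<Rightarrow> complex" where
  "D_ser = N_ser 0"

text \<open>
  A zero of \<open>D_ser\<close> gets the value \<open>0\<close> by the convention for division by zero. Below, the quotient is
  only evaluated, or expanded, where this value is irrelevant: a Taylor expansion at \<open>0\<close>, where
  \<open>D_ser 0 = 1\<close>, and a Laurent expansion, which only depends on a punctured neighbourhood.
\<close>

definition W_quot :: "nat \<Rightarrow> complex \<Rightarrow> complex" where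
  "W_quot n q = N_ser n q / D_ser q"

definition beta_coeff :: "nat \<Rightarrow> complex" where
  "beta_coeff r = fps_nth (fps_expansion (\<lambda>q. 1 / D_ser q) 0) r"

definition W_coeff :: "nat \<Rightarrow> nat \<Rightarrow> complex" where
  "W_coeff n r = fps_nth (fps_expansion (W_quot n) 0) r"

text \<open>The zero is simple, real and lies strictly between 0.29 and 0.293.\<close>

definition q0 :: complex where
  "q0 = (THE z. norm z < 1 / 2 \<and> D_ser z = 0)"

text \<open>
  The infimum is taken in \<open>ereal\<close>, where the infimum of the empty set is \<open>\<infinity>\<close>. The minimum lies in
  the interval from 0 to 1, so nothing is lost in passing back to \<open>real\<close>.
\<close>

definition R_star :: real where
  "R_star = real_of_ereal
     (min 1 (INF z\<in>{z. norm z < 1 \<and> D_ser z = 0 \<and> z \<noteq> q0}. ereal (norm z)))"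

end

theory Submission
  imports Defs "HOL-Real_Asymp.Real_Asymp"
begin

text \<open>
  The coefficients of a meromorphic function whose only singularity in a disc is a simple pole \<open>c\<close> are
  those of the principal part up to an error governed by the radius of the disc: the principal part
  expands into an exact geometric series, and Cauchy's inequality bounds the coefficients of the
  holomorphic rest (\<open>simple_pole_coeff_asymptotics\<close>). Both \<open>1 / D_ser\<close> and \<open>W_quot n\<close> are quotients
  by \<^term>\<open>D_ser\<close>, so everything rests on one fact: \<^term>\<open>D_ser\<close> has exactly one zero \<^term>\<open>q0\<close> in the
  disc of radius \<^term>\<open>R_star\<close>, this zero is simple, and \<open>norm q0 < R_star\<close>.

  For the zeros, write \<open>D_ser z = 1 - 3 z - 5 z ^ 3 + 7 z ^ 6 + \<dots>\<close>. The intermediate value theorem gives a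
  zero in the real interval from \<open>0\<close> to \<open>293 / 1000\<close>. For \<open>norm z \<le> 1 / 2\<close> and
  \<open>norm w \<le> 293 / 1000\<close> the nonlinear part contributes at most \<open>149 / 50 * norm (z - w)\<close> to
  \<open>D_ser z - D_ser w\<close>, less than the \<open>3 * norm (z - w)\<close> of the linear part
  (\<open>D_ser_near_linear\<close>). Taking for \<open>w\<close> the real zero, this shows at once that there is no other zero in the
  closed disc of radius \<open>1 / 2\<close> and that the derivative does not vanish at \<open>w\<close>. Consequently \<open>R_star \<ge> 1 / 2 > norm q0\<close>.

  The explicit constant for \<open>n = 1\<close> comes from \<open>(2 k + 1)\<^sup>2 = 8 tri k + 1\<close>, which makes
  \<open>N_ser 1 q = 8 q D_ser' q + D_ser q\<close> (\<open>N_ser_1_eq\<close>); at \<^term>\<open>q0\<close> the last term vanishes and the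
  residue is \<open>8 q0\<close>.
\<close>

section \<open>Theta series over the triangular numbers\<close>

lemma tri_add: "tri (k + j) = tri j + j * k + tri k"
proof -
  have even_prod: "even (m * (m + 1))" for m :: nat by simp
  have d: "2 * tri m = m * (m + 1)" for m
    unfolding tri_def using even_prod[of m] by simp
  have "2 * tri (k + j) = 2 * (tri j + j * k + tri k)"
    unfolding distrib_left d mult.assoc[symmetric] by (simp add: algebra_simps)
  thus ?thesis by simp
qed

lemma tri_Suc: "tri (Suc k) = Suc (tri k + k)"
  using tri_add[of k 1] by (simp add: tri_def)

lemma tri_0 [simp]: "tri 0 = 0"
  by (simp add: tri_def)

lemma le_tri: "k \<le> tri k"
  by (induction k) (simp_all add: tri_Suc)

text \<open>
  This square completion is the whole arithmetic input to the relation between \<^term>\<open>N_ser 1\<close>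
  and the derivative of \<^term>\<open>D_ser\<close>.
\<close>

lemma eight_tri: "8 * tri k + 1 = (2 * k + 1) ^ 2"
  by (induction k) (simp_all add: tri_Suc power2_eq_square algebra_simps)

lemma summable_odd_power_tri:
  fixes x :: real
  assumes "0 \<le> x" "x < 1"
  shows "summable (\<lambda>k. real (2 * k + 1) ^ m * x ^ tri k)"
proof -
  \<comment> \<open>Unlike \<open>x\<close>, the larger ratio \<open>y\<close> is strictly positive, so its powers decay exactly
      exponentially.\<close>
  define y where "y = (x + 1) / 2"
  have y: "0 < y" "y < 1" "x \<le> y" using assms by (auto simp: y_def)
  have "(\<lambda>k. real (2 * k + 1) ^ m * y ^ k) \<in> O(\<lambda>k. 1 / real k ^ 2)"
    using y by real_asymp
  from summable_comparison_test_bigo[OF _ this]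
  have s: "summable (\<lambda>k. real (2 * k + 1) ^ m * y ^ k)"
    using inverse_power_summable[of 2, where 'a = real] by (simp add: field_simps)
  show ?thesis
  proof (rule summable_comparison_test'[OF s])
    fix k :: nat assume "k \<ge> 0"
    have "x ^ tri k \<le> x ^ k" using le_tri[of k] assms by (intro power_decreasing) auto
    also have "\<dots> \<le> y ^ k" using y assms by (intro power_mono) auto
    finally show "norm (real (2 * k + 1) ^ m * x ^ tri k) \<le> real (2 * k + 1) ^ m * y ^ k"
      using assms by (simp add: mult_left_mono)
  qed
qed

definition N_term :: "nat \<Rightarrow> nat \<Rightarrow> complex \<Rightarrow> complex" where
  "N_term n k q = (-1) ^ tri k * of_nat (2 * k + 1) ^ (2 * n + 1) * q ^ tri k"

lemma norm_N_term: "norm (N_term n k q) = real (2 * k + 1) ^ (2 * n + 1) * norm q ^ tri k"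
  by (simp add: N_term_def norm_mult norm_power del: of_nat_Suc of_nat_add of_nat_mult)

lemma summable_norm_N_term: "norm q < 1 \<Longrightarrow> summable (\<lambda>k. norm (N_term n k q))"
  unfolding norm_N_term by (intro summable_odd_power_tri) auto

lemma N_term_sums: "norm q < 1 \<Longrightarrow> (\<lambda>k. N_term n k q) sums N_ser n q"
  using summable_norm_cancel[OF summable_norm_N_term[of q n]]
  by (simp add: N_ser_def N_term_def summable_sums)

text \<open>
  On a small disc around a point of the open unit disc the terms are dominated by their values at a
  single radius below 1, so the series may be differentiated term by term. Away from 0,
  differentiating the \<open>k\<close>-th term multiplies it by \<open>tri k / q\<close>, which is what the identity for
  \<^term>\<open>N_ser 1\<close> exploits.
\<close>

lemma N_ser_termwise_derivative:
  assumes "norm q < 1"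
  shows "(N_ser n has_field_derivative deriv (N_ser n) q) (at q)"
    and "(\<lambda>k. deriv (N_term n k) q) sums deriv (N_ser n) q"
proof -
  have "\<exists>g g'. \<forall>x \<in> ball 0 1. ((\<lambda>k. N_term n k x) sums g x) \<and>
      ((\<lambda>k. deriv (N_term n k) x) sums g' x) \<and> (g has_field_derivative g' x) (at x)"
  proof (rule series_and_derivative_comparison_complex)
    fix k :: nat and x :: complex
    have "N_term n k field_differentiable at x"
      unfolding N_term_def by (intro derivative_intros)
    thus "(N_term n k has_field_derivative deriv (N_term n k) x) (at x)"
      by (simp add: field_differentiable_derivI)
  next
    fix x :: complex assume x: "x \<in> ball 0 1"
    define d where "d = (1 - norm x) / 2"
    have "d > 0" "norm x + d < 1" "norm x + d \<ge> 0"
      using x by (auto simp: d_def field_simps add_nonneg_pos)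
    moreover have "norm (N_term n k y) \<le>
        norm (complex_of_real (real (2 * k + 1) ^ (2 * n + 1) * (norm x + d) ^ tri k))"
      if "y \<in> ball x d \<inter> ball 0 1" for y k
    proof -
      have "norm y \<le> norm x + d"
        using that norm_triangle_sub[of y x] by (auto simp: dist_norm norm_minus_commute)
      thus ?thesis using \<open>norm x + d \<ge> 0\<close> unfolding norm_N_term norm_of_real
        by (auto simp: abs_mult power_abs intro!: mult_left_mono power_mono)
    qed
    ultimately show "\<exists>d h. 0 < d \<and> summable h \<and> range h \<subseteq> \<real>\<^sub>\<ge>\<^sub>0 \<and>
        (\<forall>\<^sub>F k in sequentially. \<forall>y\<in>ball x d \<inter> ball 0 1. cmod (N_term n k y) \<le> cmod (h k))"
      using summable_odd_power_tri[of "norm x + d" "2 * n + 1"]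
      by (intro exI[of _ d] exI[of _ "\<lambda>k. complex_of_real (real (2 * k + 1) ^ (2 * n + 1) * (norm x + d) ^ tri k)"])
         (auto simp del: of_real_mult of_real_power of_nat_Suc intro!: always_eventually summable_of_real mult_nonneg_nonneg)
  qed auto
  then obtain g g' where g: "\<And>x. x \<in> ball 0 1 \<Longrightarrow> (\<lambda>k. N_term n k x) sums g x"
      "\<And>x. x \<in> ball 0 1 \<Longrightarrow> (\<lambda>k. deriv (N_term n k) x) sums g' x"
      "\<And>x. x \<in> ball 0 1 \<Longrightarrow> (g has_field_derivative g' x) (at x)"
    by blast
  have "N_ser n x = g x" if "x \<in> ball 0 1" for x
    using sums_unique2[OF N_term_sums[of x n] g(1)[OF that]] that by simp
  hence der: "(N_ser n has_field_derivative g' q) (at q)"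
    using has_field_derivative_transform_within_open[OF g(3)[of q], of "ball 0 1"] assms by simp
  note [simp] = DERIV_imp_deriv[OF der]
  show "(N_ser n has_field_derivative deriv (N_ser n) q) (at q)" using der by simp
  show "(\<lambda>k. deriv (N_term n k) q) sums deriv (N_ser n) q" using g(2)[of q] assms by simp
qed

lemma N_ser_holomorphic: "N_ser n holomorphic_on ball 0 1"
proof (rule holomorphic_onI)
  fix q :: complex assume "q \<in> ball 0 1"
  hence "N_ser n field_differentiable at q"
    using N_ser_termwise_derivative(1)[of q n] by (auto simp: field_differentiable_def)
  thus "N_ser n field_differentiable at q within ball 0 1"
    by (rule field_differentiable_at_within)
qed

text \<open>
  The coefficients of \<^term>\<open>N_ser 1\<close> arise from those of \<^term>\<open>D_ser\<close> through the factor
  \<open>(2 k + 1)\<^sup>2 = 8 tri k + 1\<close>, and multiplication of the \<open>k\<close>-th term by \<open>tri k\<close> is the Euler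
  operator \<open>q d/dq\<close>. At a zero of \<^term>\<open>D_ser\<close> only the derivative survives, which is the source of
  the constant 8.
\<close>

lemma N_ser_1_eq:
  assumes "norm q < 1"
  shows "N_ser 1 q = 8 * q * deriv D_ser q + D_ser q"
proof -
  have t: "N_term 1 k q = 8 * q * deriv (N_term 0 k) q + N_term 0 k q" for k
  proof -
    have "deriv (N_term 0 k) q =
        (-1) ^ tri k * of_nat (2 * k + 1) * (of_nat (tri k) * q ^ (tri k - 1))"
      unfolding N_term_def by (intro DERIV_imp_deriv) (auto intro!: derivative_eq_intros)
    hence "q * deriv (N_term 0 k) q = of_nat (tri k) * N_term 0 k q"
      by (cases "tri k") (auto simp: N_term_def)
    hence "8 * q * deriv (N_term 0 k) q + N_term 0 k q = of_nat (8 * tri k + 1) * N_term 0 k q"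
      by (simp add: algebra_simps)
    also have "\<dots> = N_term 1 k q"
      unfolding eight_tri N_term_def
      by (simp add: power2_eq_square power3_eq_cube algebra_simps)
    finally show ?thesis ..
  qed
  have "(\<lambda>k. 8 * q * deriv (N_term 0 k) q + N_term 0 k q) sums
      (8 * q * deriv (N_ser 0) q + N_ser 0 q)"
    by (intro sums_add sums_mult N_ser_termwise_derivative(2)[OF assms] N_term_sums[OF assms])
  thus ?thesis using sums_unique2[OF N_term_sums[OF assms, of 1]] t by (simp add: D_ser_def)
qed

section \<open>Numerical bounds on the disc of radius one half\<close>

text \<open>
  From the term \<open>9 x ^ 10\<close> on, consecutive exponents differ by at least 5 and the odd coefficients
  at most double, so the tail is below a geometric series with ratio \<open>2 x ^ 5 \<le> 1 / 16\<close>; the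
  constant is \<open>48 / 5 = 9 * 16 / 15\<close>.
\<close>

lemma tri_tail:
  fixes x :: real
  assumes "0 \<le> x" "x \<le> 1 / 2"
  shows "summable (\<lambda>k. real (2 * (k + 4) + 1) * x ^ tri (k + 4))"
    and "(\<Sum>k. real (2 * (k + 4) + 1) * x ^ tri (k + 4)) \<le> 48 / 5 * x ^ 10"
proof -
  show s: "summable (\<lambda>k. real (2 * (k + 4) + 1) * x ^ tri (k + 4))"
    using summable_ignore_initial_segment[OF summable_odd_power_tri[of x 1], of 4] assms by simp
  have x5: "2 * x ^ 5 \<le> 1 / 16"
    using power_mono[OF assms(2,1), of 5] by (simp add: power_divide)
  have geo: "(\<lambda>k. 9 * x ^ 10 * (2 * x ^ 5) ^ k) sums (9 * x ^ 10 * (1 / (1 - 2 * x ^ 5)))"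
    using x5 assms by (intro sums_mult geometric_sums) auto
  have le: "real (2 * (k + 4) + 1) * x ^ tri (k + 4) \<le> 9 * x ^ 10 * (2 * x ^ 5) ^ k" for k
  proof -
    have "tri (k + 4) \<ge> 10 + 5 * k" using le_tri[of k] by (simp add: tri_add) (simp add: tri_def)
    hence "x ^ tri (k + 4) \<le> x ^ (10 + 5 * k)" using assms by (intro power_decreasing) auto
    moreover have "real (2 * (k + 4) + 1) \<le> 9 * 2 ^ k" by (induction k) auto
    ultimately have "real (2 * (k + 4) + 1) * x ^ tri (k + 4) \<le> (9 * 2 ^ k) * x ^ (10 + 5 * k)"
      using assms by (intro mult_mono) auto
    also have "\<dots> = 9 * x ^ 10 * (2 * x ^ 5) ^ k" by (simp add: power_add power_mult power_mult_distrib)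
    finally show ?thesis .
  qed
  have "(\<Sum>k. real (2 * (k + 4) + 1) * x ^ tri (k + 4)) \<le> 9 * x ^ 10 * (1 / (1 - 2 * x ^ 5))"
    using suminf_le[OF le s sums_summable[OF geo]] sums_unique[OF geo] by simp
  also have "\<dots> \<le> 9 * x ^ 10 * (16 / 15)"
    using x5 assms by (intro mult_left_mono) (auto simp: field_simps)
  finally show "(\<Sum>k. real (2 * (k + 4) + 1) * x ^ tri (k + 4)) \<le> 48 / 5 * x ^ 10" by simp
qed

lemma D_ser_approx:
  assumes "norm z \<le> 1 / 2"
  shows "norm (D_ser z - (1 - 3 * z - 5 * z ^ 3 + 7 * z ^ 6)) \<le> 48 / 5 * norm z ^ 10"
proof -
  have s: "(\<lambda>k. N_term 0 k z) sums D_ser z"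
    using N_term_sums[of z 0] assms by (simp add: D_ser_def)
  have tail: "D_ser z - (\<Sum>k<4. N_term 0 k z) = (\<Sum>k. N_term 0 (k + 4) z)"
    using suminf_minus_initial_segment[OF sums_summable[OF s], of 4] s by (simp add: sums_iff)
  have "norm (\<Sum>k. N_term 0 (k + 4) z) \<le> (\<Sum>k. norm (N_term 0 (k + 4) z))"
    using assms by (intro summable_norm summable_ignore_initial_segment[OF summable_norm_N_term]) auto
  also have "\<dots> \<le> 48 / 5 * norm z ^ 10"
    unfolding norm_N_term using tri_tail(2)[of "norm z"] assms by simp
  finally have "norm (D_ser z - (\<Sum>k<4. N_term 0 k z)) \<le> 48 / 5 * norm z ^ 10"
    by (simp only: tail)
  moreover have "(\<Sum>k<4. N_term 0 k z) = 1 - 3 * z - 5 * z ^ 3 + 7 * z ^ 6"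
    by (simp add: N_term_def eval_nat_numeral tri_Suc)
  ultimately show ?thesis by simp
qed

text \<open>
  The factorisation of \<open>z ^ n - w ^ n\<close> has positive coefficients, so its second factor is largest at
  the radii themselves, where it is again a difference quotient. Hence a power series with
  nonnegative coefficients can be used as a majorant for difference quotients as well.
\<close>

lemma norm_power_diff_le:
  fixes z w :: "'a::{real_normed_field}"
  assumes "norm z \<le> r" "norm w \<le> s" "s < r"
  shows "norm (z ^ n - w ^ n) \<le> norm (z - w) * ((r ^ n - s ^ n) / (r - s))"
proof (cases n)
  case (Suc m)
  have "norm (z ^ n - w ^ n) = norm (z - w) * norm (\<Sum>p<Suc m. z ^ p * w ^ (m - p))"
    unfolding Suc power_diff_sumr2 by (simp only: norm_mult diff_Suc_Suc mult.commute)
  also have "norm (\<Sum>p<Suc m. z ^ p * w ^ (m - p)) \<le> (\<Sum>p<Suc m. r ^ p * s ^ (m - p))"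
    using assms order_trans[OF norm_ge_zero assms(1)] order_trans[OF norm_ge_zero assms(2)]
    by (intro sum_norm_le) (auto simp: norm_mult norm_power intro!: mult_mono power_mono)
  also have "(\<Sum>p<Suc m. r ^ p * s ^ (m - p)) = (r ^ n - s ^ n) / (r - s)"
    unfolding Suc power_diff_sumr2 using assms by (simp add: mult.commute)
  finally show ?thesis by (simp add: mult_left_mono)
qed simp

text \<open>
  The part of \<^term>\<open>D_ser\<close> beyond \<open>1 - 3 z\<close> contracts with a constant below 3. With
  \<open>P x = 5 x ^ 3 + 7 x ^ 6 + 9 x ^ 10 + \<dots>\<close> collecting the absolute values of its coefficients, that
  constant is the difference quotient of \<open>P\<close> between the radii \<open>1 / 2\<close> and \<open>293 / 1000\<close>,
  about 2.963. The linear term \<open>- 3 z\<close> therefore dominates on the whole closed disc of radius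
  \<open>1 / 2\<close>, provided that one of the two points stays as close to 0 as the zero does.
\<close>

lemma D_ser_near_linear:
  assumes z: "norm z \<le> 1 / 2" and w: "norm w \<le> 293 / 1000"
  shows "norm (D_ser z - D_ser w + 3 * (z - w)) \<le> 149 / 50 * norm (z - w)"
proof -
  define P where "P x = (\<Sum>k. real (2 * (k + 2) + 1) * x ^ tri (k + 2))" for x :: real
  have Psum: "summable (\<lambda>k. real (2 * (k + 2) + 1) * x ^ tri (k + 2))"
    if "0 \<le> x" "x < 1" for x :: real
    using summable_ignore_initial_segment[OF summable_odd_power_tri[of x 1], of 2] that by simp
  have Psplit: "P x = 5 * x ^ 3 + 7 * x ^ 6 + (\<Sum>k. real (2 * (k + 4) + 1) * x ^ tri (k + 4))"
    if "0 \<le> x" "x < 1" for x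
  proof -
    have "(\<Sum>k<2. real (2 * (k + 2) + 1) * x ^ tri (k + 2)) = 5 * x ^ 3 + 7 * x ^ 6"
      by (simp add: eval_nat_numeral tri_Suc)
    thus ?thesis using suminf_split_initial_segment[OF Psum[OF that], of 2]
      by (simp add: P_def eval_nat_numeral)
  qed
  let ?r = "1 / 2 :: real" and ?s = "293 / 1000 :: real"
  have "P ?r \<le> 5 * ?r ^ 3 + 7 * ?r ^ 6 + 48 / 5 * ?r ^ 10"
    using tri_tail(2)[of ?r] by (simp add: Psplit)
  moreover have "P ?s \<ge> 5 * ?s ^ 3 + 7 * ?s ^ 6"
    unfolding Psplit[of ?s, simplified] using tri_tail(1)[of ?s] by (auto intro!: suminf_nonneg)
  ultimately have bound: "(P ?r - P ?s) / (?r - ?s) \<le> 149 / 50"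
    by (simp add: power_divide)
  have sz: "(\<lambda>k. N_term 0 k z) sums D_ser z" and sw: "(\<lambda>k. N_term 0 k w) sums D_ser w"
    using N_term_sums[of _ 0] z w by (simp_all add: D_ser_def)
  have diff: "(\<lambda>k. N_term 0 k z - N_term 0 k w) sums (D_ser z - D_ser w)"
    using sz sw by (rule sums_diff)
  have "(\<lambda>k. N_term 0 (k + 2) z - N_term 0 (k + 2) w) sums
      (D_ser z - D_ser w - (\<Sum>k<2. N_term 0 k z - N_term 0 k w))"
    by (rule sums_split_initial_segment[OF diff])
  also have "D_ser z - D_ser w - (\<Sum>k<2. N_term 0 k z - N_term 0 k w) = D_ser z - D_ser w + 3 * (z - w)"
    by (simp add: numeral_2_eq_2 N_term_def tri_Suc algebra_simps)
  finally have s: "(\<lambda>k. N_term 0 (k + 2) z - N_term 0 (k + 2) w) sums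
      (D_ser z - D_ser w + 3 * (z - w))" .
  have major: "(\<lambda>k. norm (z - w) * ((real (2 * (k + 2) + 1) * ?r ^ tri (k + 2)
      - real (2 * (k + 2) + 1) * ?s ^ tri (k + 2)) / (?r - ?s))) sums
      (norm (z - w) * ((P ?r - P ?s) / (?r - ?s)))"
    unfolding P_def by (intro sums_mult sums_divide sums_diff summable_sums Psum) auto
  have "norm (D_ser z - D_ser w + 3 * (z - w)) \<le> norm (z - w) * ((P ?r - P ?s) / (?r - ?s))"
  proof (rule norm_sums_le[OF s major])
    fix k :: nat
    have "norm (N_term 0 (k + 2) z - N_term 0 (k + 2) w) =
        real (2 * (k + 2) + 1) * norm (z ^ tri (k + 2) - w ^ tri (k + 2))"
      by (simp add: N_term_def right_diff_distrib[symmetric] norm_mult norm_power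
        del: of_nat_Suc of_nat_add of_nat_mult)
    also have "\<dots> \<le> real (2 * (k + 2) + 1) *
        (norm (z - w) * ((?r ^ tri (k + 2) - ?s ^ tri (k + 2)) / (?r - ?s)))"
      using z w by (intro mult_left_mono norm_power_diff_le) auto
    finally show "norm (N_term 0 (k + 2) z - N_term 0 (k + 2) w) \<le> norm (z - w) *
        ((real (2 * (k + 2) + 1) * ?r ^ tri (k + 2)
          - real (2 * (k + 2) + 1) * ?s ^ tri (k + 2)) / (?r - ?s))"
      by (simp add: right_diff_distrib mult_ac)
  qed
  also have "\<dots> \<le> norm (z - w) * (149 / 50)"
    using bound by (intro mult_left_mono) auto
  finally show ?thesis by (simp add: mult.commute)
qed

section \<open>The simple zero\<close>

text \<open>
  \<^term>\<open>D_ser\<close> is real on the real axis, equals 1 at 0, and its leading part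
  \<open>1 - 3 x - 5 x ^ 3 + 7 x ^ 6\<close> is about \<open>- 0.00034\<close> at \<open>x = 293 / 1000\<close>, while the
  remaining terms contribute less than \<open>0.00005\<close> there.
\<close>

lemma D_ser_has_positive_zero:
  obtains x where "0 < x" "x < 293 / 1000" "D_ser (complex_of_real x) = 0"
proof -
  let ?h = "\<lambda>x. Re (D_ser (complex_of_real x))" and ?s = "293 / 1000 :: real"
  have real_valued: "D_ser (complex_of_real x) = of_real (?h x)" if "0 \<le> x" "x < 1" for x
  proof -
    have "(\<lambda>k. Im (N_term 0 k (complex_of_real x))) sums Im (D_ser (complex_of_real x))"
      using N_term_sums[of "of_real x" 0] that by (intro sums_Im) (simp add: D_ser_def)
    moreover have "Im (N_term 0 k (complex_of_real x)) = 0" for k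
    proof -
      have "N_term 0 k (complex_of_real x) \<in> \<real>" unfolding N_term_def by simp
      thus ?thesis by (simp add: complex_is_Real_iff)
    qed
    ultimately have "Im (D_ser (complex_of_real x)) = 0" by (simp add: sums_iff)
    thus ?thesis by (simp add: complex_eq_iff)
  qed
  have "continuous_on (ball 0 1) D_ser"
    unfolding D_ser_def by (intro holomorphic_on_imp_continuous_on N_ser_holomorphic)
  hence "continuous_on {0..?s} (\<lambda>x. D_ser (complex_of_real x))"
    by (rule continuous_on_compose2) (auto intro: continuous_on_of_real continuous_on_id)
  hence cont: "continuous_on {0..?s} ?h"
    by (rule continuous_on_Re)
  have "?h 0 = 1" using D_ser_approx[of 0] by simp
  moreover have "?h ?s < 0"
  proof -
    define E where "E = D_ser (of_real ?s) - (1 - 3 * of_real ?s - 5 * of_real ?s ^ 3 + 7 * of_real ?s ^ 6)"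
    have "norm E \<le> 48 / 5 * ?s ^ 10"
      using D_ser_approx[of "of_real ?s"] unfolding E_def norm_of_real by simp
    hence "Re E \<le> 48 / 5 * ?s ^ 10" using complex_Re_le_cmod order_trans by blast
    moreover have "D_ser (of_real ?s) = of_real (1 - 3 * ?s - 5 * ?s ^ 3 + 7 * ?s ^ 6) + E"
      unfolding E_def by simp
    hence "?h ?s = (1 - 3 * ?s - 5 * ?s ^ 3 + 7 * ?s ^ 6) + Re E"
      by (simp only: plus_complex.sel Re_complex_of_real)
    ultimately show ?thesis by (simp add: power_divide)
  qed
  ultimately obtain x where x: "0 \<le> x" "x \<le> ?s" "?h x = 0"
    using IVT2'[of ?h ?s 0 0] cont by auto
  moreover have "x \<noteq> 0" using x(3) \<open>?h 0 = 1\<close> by auto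
  moreover have "x \<noteq> ?s" using x(3) \<open>?h ?s < 0\<close> by (metis order_less_irrefl)
  ultimately show ?thesis using real_valued[of x] by (intro that[of x]) auto
qed

text \<open>
  Subtracting the contraction constant 149/50 from the slope 3 leaves 1/50. This one lower bound
  gives both uniqueness and simplicity of the zero.
\<close>

lemma D_ser_expansive:
  assumes "norm z \<le> 1 / 2" "norm w \<le> 293 / 1000"
  shows "norm (z - w) / 50 \<le> norm (D_ser z - D_ser w)"
proof -
  have "norm (3 * (z - w)) \<le> norm (D_ser z - D_ser w + 3 * (z - w)) + norm (D_ser z - D_ser w)"
    using norm_triangle_ineq4[of "D_ser z - D_ser w + 3 * (z - w)" "D_ser z - D_ser w"] by simp
  moreover have "norm (3 * (z - w)) = 3 * norm (z - w)" by (simp only: norm_mult norm_numeral)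
  ultimately show ?thesis using D_ser_near_linear[OF assms] by linarith
qed

lemma q0_props:
  shows q0_nonzero: "q0 \<noteq> 0" and norm_q0: "norm q0 < 293 / 1000" and D_ser_q0: "D_ser q0 = 0"
    and q0_unique: "\<And>z. norm z \<le> 1 / 2 \<Longrightarrow> D_ser z = 0 \<Longrightarrow> z = q0"
proof -
  obtain x where x: "0 < x" "x < 293 / 1000" "D_ser (complex_of_real x) = 0"
    by (rule D_ser_has_positive_zero)
  have uniq: "z = of_real x" if "norm z \<le> 1 / 2" "D_ser z = 0" for z
    using D_ser_expansive[OF that(1), of "of_real x"] that(2) x by simp
  have eq: "q0 = of_real x" unfolding q0_def
    by (rule the_equality) (use x uniq in auto)
  show "q0 \<noteq> 0" "norm q0 < 293 / 1000" "D_ser q0 = 0"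
    "\<And>z. norm z \<le> 1 / 2 \<Longrightarrow> D_ser z = 0 \<Longrightarrow> z = q0"
    unfolding eq using x uniq by simp_all
qed

lemma D_ser_has_derivative:
  "norm z < 1 \<Longrightarrow> (D_ser has_field_derivative deriv D_ser z) (at z)"
  unfolding D_ser_def by (rule N_ser_termwise_derivative(1))

text \<open>
  The difference quotients at the zero are bounded below by 1/50, hence so is their limit.
\<close>

lemma deriv_D_ser_q0: "deriv D_ser q0 \<noteq> 0"
proof -
  have lim: "(\<lambda>z. norm ((D_ser z - D_ser q0) / (z - q0))) \<midarrow>q0\<rightarrow> norm (deriv D_ser q0)"
    using D_ser_has_derivative[of q0] norm_q0
    by (intro tendsto_norm) (simp add: has_field_derivative_iff)
  have "eventually (\<lambda>z. z \<in> ball 0 (1 / 2) - {q0}) (at q0)"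
    using norm_q0 eventually_at_in_open[of "ball 0 (1 / 2)" q0] by simp
  hence "eventually (\<lambda>z. 1 / 50 \<le> norm ((D_ser z - D_ser q0) / (z - q0))) (at q0)"
  proof eventually_elim
    case (elim z)
    thus ?case using D_ser_expansive[of z q0] norm_q0
      by (simp add: norm_divide field_simps)
  qed
  from tendsto_lowerbound[OF lim this] show ?thesis by auto
qed

text \<open>
  Every zero in the unit disc other than \<^term>\<open>q0\<close> has norm above 1/2, so the infimum, and with it the minimum with 1,
  is at least 1/2. In particular \<^term>\<open>R_star\<close> lies strictly beyond the zero itself.
\<close>

lemma R_star_bounds: "1 / 2 \<le> R_star" "R_star \<le> 1"
  and R_star_zero_free: "norm z < R_star \<Longrightarrow> D_ser z = 0 \<Longrightarrow> z = q0"
proof -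
  let ?Z = "{z. norm z < 1 \<and> D_ser z = 0 \<and> z \<noteq> q0}"
  let ?m = "min 1 (INF z\<in>?Z. ereal (norm z))"
  have "ereal (1 / 2) \<le> (INF z\<in>?Z. ereal (norm z))"
    using q0_unique by (intro INF_greatest) force
  hence lo: "ereal (1 / 2) \<le> ?m" by (simp add: one_ereal_def)
  have hi: "?m \<le> ereal 1" by (simp add: one_ereal_def)
  have m: "?m = ereal R_star"
    unfolding R_star_def using lo hi by (cases ?m) auto
  from lo hi show *: "1 / 2 \<le> R_star" "R_star \<le> 1" unfolding m by simp_all
  show "z = q0" if "norm z < R_star" "D_ser z = 0"
  proof (rule ccontr)
    assume "z \<noteq> q0"
    with that * have "z \<in> ?Z" by auto
    hence "?m \<le> ereal (norm z)" by (intro min.coboundedI2 INF_lower)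
    thus False using that unfolding m by simp
  qed
qed

section \<open>Functions with a single simple pole in a disc\<close>

text \<open>
  Two removable singularities: first \<open>D z = (z - c) * g z\<close> with \<open>g\<close> holomorphic and free of zeros,
  then \<open>P / g\<close> minus its value at \<open>c\<close> is divisible by \<open>z - c\<close>. Since \<open>g c = D' c\<close>,
  the residue is \<open>P c / D' c\<close>.
\<close>

lemma simple_zero_quotient_decomposition:
  assumes S: "open S" and D: "D holomorphic_on S" and P: "P holomorphic_on S"
    and c: "c \<in> S" "D c = 0" "deriv D c \<noteq> 0"
    and nz: "\<And>z. z \<in> S \<Longrightarrow> z \<noteq> c \<Longrightarrow> D z \<noteq> 0"
  obtains H where "H holomorphic_on S"
    "\<And>z. z \<in> S - {c} \<Longrightarrow> P z / D z = P c / (deriv D c * (z - c)) + H z"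
proof -
  define g where "g = (\<lambda>z. if z = c then deriv D c else (D z - D c) / (z - c))"
  have g: "g holomorphic_on S"
    unfolding g_def by (rule pole_lemma_open[OF D S])
  have "g z \<noteq> 0" if "z \<in> S" for z
    using nz[OF that] c by (auto simp: g_def)
  hence h: "(\<lambda>z. P z / g z) holomorphic_on S"
    using g P by (intro holomorphic_intros) auto
  have "P z / g z = (z - c) * (P z / D z)" if "z \<in> S - {c}" for z
    using that c by (simp add: g_def)
  from pole_theorem_open[OF h S this] show ?thesis
    by (rule that) (auto simp: g_def)
qed

lemma has_fps_expansion_geometric_pole:
  fixes a c :: complex
  assumes "c \<noteq> 0"
  shows "(\<lambda>z. a / (z - c)) has_fps_expansion Abs_fps (\<lambda>r. - (a / c) * c powi (- int r))"
proof -
  let ?F = "Abs_fps (\<lambda>r. - (a / c) * c powi (- int r))"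
  \<comment> \<open>Multiplying by the denominator telescopes; then the denominator is cancelled.\<close>
  have "?F * (fps_X - fps_const c) = fps_const a"
  proof (rule fps_ext)
    fix r show "fps_nth (?F * (fps_X - fps_const c)) r = fps_nth (fps_const a) r"
      using assms by (cases r) (auto simp: right_diff_distrib power_int_minus field_simps)
  qed
  moreover have "fps_const c \<noteq> fps_X" by (metis assms fps_X_nth fps_nth_fps_const zero_neq_one)
  moreover have nz: "fps_nth (fps_X - fps_const c) 0 \<noteq> 0" using assms by simp
  ultimately have "?F = fps_const a / (fps_X - fps_const c)"
    by (metis eq_iff_diff_eq_0 nonzero_mult_div_cancel_right)
  moreover have "(\<lambda>z. a / (z - c)) has_fps_expansion fps_const a / (fps_X - fps_const c)"
    using nz by (intro has_fps_expansion_divide' fps_expansion_intros)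
  ultimately show ?thesis by simp
qed

lemma fps_expansion_coeffs_bigo:
  assumes H: "H holomorphic_on ball 0 \<rho>" and R: "0 < R" "R < \<rho>"
  shows "(\<lambda>r. fps_nth (fps_expansion H 0) r) \<in> O(\<lambda>r. complex_of_real (R powi (- int r)))"
proof -
  have sub: "cball 0 R \<subseteq> ball (0 :: complex) \<rho>" using R by auto
  have cont: "continuous_on (cball 0 R) H"
    using H sub holomorphic_on_imp_continuous_on holomorphic_on_subset by blast
  obtain B where B: "\<And>z. z \<in> cball 0 R \<Longrightarrow> norm (H z) \<le> B"
    using compact_imp_bounded[OF compact_continuous_image[OF cont compact_cball]]
    unfolding bounded_iff by blast
  show ?thesis
  \<comment> \<open>\<open>B\<close> may vanish, but the constant in the Landau symbol has to be positive.\<close>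
  proof (rule landau_o.bigI[where c = "\<bar>B\<bar> + 1"])
    show "\<forall>\<^sub>F r in at_top. norm (fps_nth (fps_expansion H 0) r)
        \<le> (\<bar>B\<bar> + 1) * norm (complex_of_real (R powi (- int r)))"
    proof (intro always_eventually allI)
      fix r
      have "norm ((deriv ^^ r) H 0) \<le> fact r * B / R ^ r"
      proof (rule Cauchy_inequality[OF _ cont R(1)])
        show "H holomorphic_on ball 0 R" using H sub ball_subset_cball holomorphic_on_subset by blast
      qed (use B in auto)
      hence "norm (fps_nth (fps_expansion H 0) r) \<le> B / R ^ r"
        by (simp add: fps_expansion_def norm_divide field_simps)
      also have "\<dots> \<le> (\<bar>B\<bar> + 1) / R ^ r" using R by (intro divide_right_mono) auto
      finally show "norm (fps_nth (fps_expansion H 0) r)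
          \<le> (\<bar>B\<bar> + 1) * norm (complex_of_real (R powi (- int r)))"
        using R by (simp add: power_int_minus norm_inverse norm_power field_class.field_divide_inverse)
    qed
  qed simp
qed

text \<open>
  Near 0 the function is the sum of an exact geometric series from the pole and the expansion of the
  holomorphic remainder, whose coefficients Cauchy's inequality controls.
\<close>

lemma simple_pole_coeff_asymptotics:
  assumes H: "H holomorphic_on ball 0 \<rho>" and c: "c \<noteq> 0" and R: "0 < R" "R < \<rho>"
    and f: "\<And>z. z \<in> ball 0 \<rho> - {c} \<Longrightarrow> f z = a / (z - c) + H z"
  shows "(\<lambda>r. fps_nth (fps_expansion f 0) r - (- (a / c) * c powi (- int r)))
    \<in> O(\<lambda>r. complex_of_real (R powi (- int r)))"
proof -
  have "(\<lambda>z. a / (z - c) + H z) has_fps_expansion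
      Abs_fps (\<lambda>r. - (a / c) * c powi (- int r)) + fps_expansion H 0"
    using R H by (intro has_fps_expansion_add has_fps_expansion_geometric_pole c
        has_fps_expansion_fps_expansion[of "ball 0 \<rho>"]) auto
  moreover have "eventually (\<lambda>z. z \<in> ball 0 \<rho> - {c}) (nhds 0)"
    using R c by (intro eventually_nhds_in_open) auto
  hence "eventually (\<lambda>z. f z = a / (z - c) + H z) (nhds 0)"
    by eventually_elim (use f in auto)
  ultimately have "f has_fps_expansion
      Abs_fps (\<lambda>r. - (a / c) * c powi (- int r)) + fps_expansion H 0"
    using has_fps_expansion_cong by fast
  hence "fps_expansion f 0 = Abs_fps (\<lambda>r. - (a / c) * c powi (- int r)) + fps_expansion H 0"
    by (rule fps_expansion_eqI)
  thus ?thesis using fps_expansion_coeffs_bigo[OF H R] by simp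
qed

text \<open>
  When the error radius exceeds the modulus of the pole, rescaling by \<open>c ^ r\<close> turns the error into
  one of geometric decay. All statements on eventual nonvanishing and on ratios follow from this limit.
\<close>

lemma simple_pole_coeff_limit:
  fixes u :: "nat \<Rightarrow> complex"
  assumes c: "c \<noteq> 0" "norm c < R"
    and u: "(\<lambda>r. u r - A * c powi (- int r)) \<in> O(\<lambda>r. complex_of_real (R powi (- int r)))"
  shows "(\<lambda>r. u r * c ^ r) \<longlonglongrightarrow> A"
proof -
  have R: "R > 0" using c by (meson le_less_trans norm_ge_zero)
  have "(\<lambda>r. (u r - A * c powi (- int r)) * c ^ r) \<in> O(\<lambda>r. complex_of_real (R powi (- int r)) * c ^ r)"
    using u by (rule landau_o.big.mult) simp
  also have "(\<lambda>r. complex_of_real (R powi (- int r)) * c ^ r) = (\<lambda>r. (c / of_real R) ^ r)"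
    by (simp add: power_int_minus power_divide field_simps)
  also have "(\<lambda>r. (u r - A * c powi (- int r)) * c ^ r) = (\<lambda>r. u r * c ^ r - A)"
    using c by (simp add: power_int_minus left_diff_distrib mult.assoc)
  finally have big: "(\<lambda>r. u r * c ^ r - A) \<in> O(\<lambda>r. (c / of_real R) ^ r)" .
  have "(\<lambda>r. (c / of_real R) ^ r) \<longlonglongrightarrow> 0"
    using c R by (intro LIMSEQ_power_zero) (simp add: norm_divide)
  hence "(\<lambda>r. (c / of_real R) ^ r) \<in> o(\<lambda>_. 1)" by (simp add: smalloI_tendsto)
  from landau_o.big_small_trans[OF big this] have "(\<lambda>r. u r * c ^ r - A) \<longlonglongrightarrow> 0"
    using smalloD_tendsto by fastforce
  thus ?thesis by (simp add: LIM_zero_iff)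
qed

lemma fls_prpart_laurent_expansion_simple_pole:
  assumes H: "H holomorphic_on S" and S: "open S" "c \<in> S"
    and f: "\<And>z. z \<in> S - {c} \<Longrightarrow> f z = a / (z - c) + H z"
  shows "fls_prpart (laurent_expansion f c) = [:0, a:]"
proof -
  have "H analytic_on {c}" using H S analytic_at by blast
  hence "(\<lambda>w. H (c + w)) has_laurent_expansion fps_to_fls (fps_expansion H c)"
    by (intro has_laurent_expansion_fps analytic_at_imp_has_fps_expansion)
  hence "(\<lambda>w. a * inverse w + H (c + w)) has_laurent_expansion
      fls_const a * inverse fls_X + fps_to_fls (fps_expansion H c)"
    by (intro laurent_expansion_intros)
  moreover have "eventually (\<lambda>w. c + w \<in> S) (at 0)"
  proof -
    have "eventually (\<lambda>z. z \<in> S) (at c)" using S eventually_at_in_open' by blast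
    thus ?thesis by (subst (asm) at_to_0) (simp add: eventually_filtermap add.commute)
  qed
  hence "eventually (\<lambda>w. a * inverse w + H (c + w) = f (c + w)) (at 0)"
    using eventually_neq_at_within[of 0]
    by eventually_elim (simp add: f field_class.field_divide_inverse)
  ultimately have "(\<lambda>w. f (c + w)) has_laurent_expansion
      fls_const a * inverse fls_X + fps_to_fls (fps_expansion H c)"
    by (simp cong: has_laurent_expansion_cong)
  hence "laurent_expansion f c = fls_const a * inverse fls_X + fps_to_fls (fps_expansion H c)"
    by (rule laurent_expansion_eqI)
  thus ?thesis
    by (auto intro!: poly_eqI simp: fls_inverse_X coeff_pCons split: nat.splits)
qed

section \<open>Expansion of the quotients\<close>

lemma quotient_by_D_ser_decomposition:
  assumes "P holomorphic_on ball 0 1"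
  shows "\<exists>H. H holomorphic_on ball 0 R_star \<and>
    (\<forall>q \<in> ball 0 R_star - {q0}. P q / D_ser q = P q0 / (deriv D_ser q0 * (q - q0)) + H q)"
proof -
  have sub: "ball 0 R_star \<subseteq> ball (0 :: complex) 1" using R_star_bounds by auto
  have D: "D_ser holomorphic_on ball 0 R_star"
    unfolding D_ser_def using N_ser_holomorphic sub by (rule holomorphic_on_subset)
  show ?thesis
  proof (rule simple_zero_quotient_decomposition[OF open_ball D holomorphic_on_subset[OF assms sub] _ D_ser_q0 deriv_D_ser_q0])
    show "q0 \<in> ball 0 R_star" using norm_q0 R_star_bounds by simp
    show "D_ser z \<noteq> 0" if "z \<in> ball 0 R_star" "z \<noteq> q0" for z
      using R_star_zero_free[of z] that by auto
  qed blast
qed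

theorem theorem7p3:
  "(\<exists>(H_D :: complex \<Rightarrow> complex) (H_W :: nat \<Rightarrow> complex \<Rightarrow> complex).
      H_D holomorphic_on ball 0 R_star \<and>
      (\<forall>n. H_W n holomorphic_on ball 0 R_star) \<and>
      (\<forall>q\<in>ball 0 R_star - {q0}.
         1 / D_ser q = 1 / (deriv D_ser q0 * (q - q0)) + H_D q) \<and>
      (\<forall>n. \<forall>q\<in>ball 0 R_star - {q0}.
         W_quot n q = N_ser n q0 / (deriv D_ser q0 * (q - q0)) + H_W n q)) \<and>
   (\<forall>R::real. 1 / 2 < R \<and> R < R_star \<longrightarrow>
      (\<lambda>r::nat. beta_coeff r - (- (q0 powi (- int r) / (q0 * deriv D_ser q0))))
        \<in> O(\<lambda>r. complex_of_real (R powi (- int r)))) \<and>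
   (\<forall>(R::real) n. 1 / 2 < R \<and> R < R_star \<longrightarrow>
      (\<lambda>r::nat. W_coeff n r - (- (N_ser n q0 / (q0 * deriv D_ser q0)) * q0 powi (- int r)))
        \<in> O(\<lambda>r. complex_of_real (R powi (- int r)))) \<and>
   (\<forall>\<^sub>F r in sequentially. beta_coeff r \<noteq> 0) \<and>
   (\<forall>n. (\<lambda>r. W_coeff n r / beta_coeff r) \<longlonglongrightarrow> N_ser n q0) \<and>
   (\<forall>n. fls_prpart (laurent_expansion (W_quot n) q0) \<noteq> 0 \<longleftrightarrow> N_ser n q0 \<noteq> 0) \<and>
   (\<forall>n. N_ser n q0 \<noteq> 0 \<longrightarrow>
      (\<forall>\<^sub>F r in sequentially. W_coeff n r \<noteq> 0) \<and>
      (\<lambda>r. W_coeff n (Suc r) / W_coeff n r) \<longlonglongrightarrow> inverse q0) \<and>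
   (\<forall>R::real. 1 / 2 < R \<and> R < R_star \<longrightarrow>
      (\<lambda>r::nat. W_coeff 1 r - (- 8 * q0 powi (- int r)))
        \<in> O(\<lambda>r. complex_of_real (R powi (- int r))))"
proof -
  let ?d = "deriv D_ser q0" and ?B = "ball 0 R_star :: complex set"
  note nz = q0_nonzero deriv_D_ser_q0
  have q0_in: "q0 \<in> ?B" using norm_q0 R_star_bounds by simp
  obtain H_D where HD: "H_D holomorphic_on ?B"
      "\<And>q. q \<in> ?B - {q0} \<Longrightarrow> 1 / D_ser q = 1 / (?d * (q - q0)) + H_D q"
    using quotient_by_D_ser_decomposition[of "\<lambda>_. 1"] by auto
  have "\<exists>H. H holomorphic_on ?B \<and>
      (\<forall>q \<in> ?B - {q0}. W_quot n q = N_ser n q0 / (?d * (q - q0)) + H q)" for n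
    unfolding W_quot_def by (intro quotient_by_D_ser_decomposition N_ser_holomorphic)
  then obtain H_W where HW: "\<And>n. H_W n holomorphic_on ?B"
      "\<And>n q. q \<in> ?B - {q0} \<Longrightarrow> W_quot n q = N_ser n q0 / (?d * (q - q0)) + H_W n q"
    by metis

  have beta: "(\<lambda>r. beta_coeff r - - (1 / (q0 * ?d)) * q0 powi (- int r))
      \<in> O(\<lambda>r. complex_of_real (R powi (- int r)))" if "0 < R" "R < R_star" for R
    using simple_pole_coeff_asymptotics[OF HD(1) nz(1) that, of _ "1 / ?d"] HD(2)
    by (simp add: beta_coeff_def mult.commute)
  have W: "(\<lambda>r. W_coeff n r - - (N_ser n q0 / (q0 * ?d)) * q0 powi (- int r))
      \<in> O(\<lambda>r. complex_of_real (R powi (- int r)))" if "0 < R" "R < R_star" for R n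
    using simple_pole_coeff_asymptotics[OF HW(1) nz(1) that, of _ "N_ser n q0 / ?d"] HW(2)
    by (simp add: W_coeff_def mult.commute)

  \<comment> \<open>For the limits any error radius strictly between \<open>norm q0\<close> and \<open>R_star\<close> will do; \<open>2 / 5\<close> lies
      between \<open>293 / 1000\<close> and \<open>1 / 2\<close>.\<close>
  have rad: "norm q0 < 2 / 5" "0 < (2 / 5 :: real)" "2 / 5 < R_star"
    using norm_q0 R_star_bounds by auto
  have beta_lim: "(\<lambda>r. beta_coeff r * q0 ^ r) \<longlonglongrightarrow> - (1 / (q0 * ?d))"
    by (rule simple_pole_coeff_limit[OF nz(1) rad(1) beta[OF rad(2,3)]])
  have W_lim: "(\<lambda>r. W_coeff n r * q0 ^ r) \<longlonglongrightarrow> - (N_ser n q0 / (q0 * ?d))" for n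
    by (rule simple_pole_coeff_limit[OF nz(1) rad(1) W[OF rad(2,3)]])

  have beta_ev: "\<forall>\<^sub>F r in sequentially. beta_coeff r \<noteq> 0"
    using tendsto_imp_eventually_ne[OF beta_lim, of 0] nz by (auto elim!: eventually_mono)
  have ratio: "(\<lambda>r. W_coeff n r / beta_coeff r) \<longlonglongrightarrow> N_ser n q0" for n
    using tendsto_divide[OF W_lim[of n] beta_lim] nz by simp
  have prpart: "fls_prpart (laurent_expansion (W_quot n) q0) \<noteq> 0 \<longleftrightarrow> N_ser n q0 \<noteq> 0" for n
    using fls_prpart_laurent_expansion_simple_pole[OF HW(1)[of n] open_ball q0_in, of _ "N_ser n q0 / ?d"]
      HW(2) nz by simp
  have W_ev: "\<forall>\<^sub>F r in sequentially. W_coeff n r \<noteq> 0"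
    and W_ratio: "(\<lambda>r. W_coeff n (Suc r) / W_coeff n r) \<longlonglongrightarrow> inverse q0"
    if N: "N_ser n q0 \<noteq> 0" for n
  proof -
    show "\<forall>\<^sub>F r in sequentially. W_coeff n r \<noteq> 0"
      using tendsto_imp_eventually_ne[OF W_lim, of n 0] nz N by (auto elim!: eventually_mono)
    have "(\<lambda>r. W_coeff n (Suc r) * q0 ^ Suc r / (W_coeff n r * q0 ^ r) / q0) \<longlonglongrightarrow>
        - (N_ser n q0 / (q0 * ?d)) / - (N_ser n q0 / (q0 * ?d)) / q0"
      using nz N by (intro tendsto_divide LIMSEQ_Suc[OF W_lim] W_lim tendsto_const) auto
    thus "(\<lambda>r. W_coeff n (Suc r) / W_coeff n r) \<longlonglongrightarrow> inverse q0"
      using nz N by (simp add: field_simps)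
  qed
  have "N_ser 1 q0 / (q0 * ?d) = 8"
    using N_ser_1_eq[of q0] norm_q0 D_ser_q0 nz by simp
  hence W1: "(\<lambda>r. W_coeff 1 r - (- 8 * q0 powi (- int r)))
      \<in> O(\<lambda>r. complex_of_real (R powi (- int r)))" if "0 < R" "R < R_star" for R
    using W[OF that, of 1] by simp
  show ?thesis
  proof (intro conjI allI impI)
    show "\<exists>(H_D :: complex \<Rightarrow> complex) (H_W :: nat \<Rightarrow> complex \<Rightarrow> complex).
      H_D holomorphic_on ?B \<and> (\<forall>n. H_W n holomorphic_on ?B) \<and>
      (\<forall>q\<in>?B - {q0}. 1 / D_ser q = 1 / (?d * (q - q0)) + H_D q) \<and>
      (\<forall>n. \<forall>q\<in>?B - {q0}. W_quot n q = N_ser n q0 / (?d * (q - q0)) + H_W n q)"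
      using HD HW by blast
  next
    fix R :: real assume "1 / 2 < R \<and> R < R_star"
    thus "(\<lambda>r. beta_coeff r - - (q0 powi (- int r) / (q0 * ?d)))
        \<in> O(\<lambda>r. complex_of_real (R powi (- int r)))"
      using beta[of R] by simp
  next
    fix R :: real and n assume "1 / 2 < R \<and> R < R_star"
    thus "(\<lambda>r. W_coeff n r - - (N_ser n q0 / (q0 * ?d)) * q0 powi (- int r))
        \<in> O(\<lambda>r. complex_of_real (R powi (- int r)))"
      by (intro W) auto
  next
    fix R :: real assume "1 / 2 < R \<and> R < R_star"
    thus "(\<lambda>r. W_coeff 1 r - - 8 * q0 powi (- int r))
        \<in> O(\<lambda>r. complex_of_real (R powi (- int r)))"
      by (intro W1) auto
  qed (use beta_ev ratio prpart W_ev W_ratio in auto)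
qed

end
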